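(* Let $U$ be a nonempty set, $I$ an interpretation over $U$, $D\subseteq U$ and $E\subseteq\mathcal P(U)$. Let $D_0\subseteq D$ and $E_0\subseteq E$ be countable and nonempty. Then there exist countable sets $N$ and $M$ with $D_0\subseteq N\subseteq D$ and $E_0\subseteq M\subseteq E$ such that $\langle I,N,M\rangle$ is an elementary substructure of $\langle I,D,E\rangle$, i.e. $\langle I,N,M\rangle\subseteq_E\langle I,D,E\rangle$.
   Context: **Syntax.** Relation symbols $R=\mathbb N$, first-order variables $V=\mathbb N$ and second-order (monadic) variables $V_2=\mathbb N$ (the two kinds of variables form separate namespaces). MSO formulas: $\varphi,\psi ::= r(x,y)\mid X(x)\mid\neg\varphi\mid\varphi\wedge\psi\mid\exists x.\varphi\mid\exists X.\varphi$ with $r\in R$, $x,y\in V$, $X\in V_2$ (no equality). **Semantics.** $U$ is a fixed nonempty set (the type of individuals). An interpretation $I$ over $U$ assigns to each $r\in R$ a binary relation $I(r)\subseteq U\times U$. Given $I$, a set $D\subseteq U$, a family $E\subseteq\mathcal P(U)$ (no closure condition on $E$), and assignments $g:V\to U$, $G:V_2\to\mathcal P(U)$, truth $\langle I,D,E\rangle,g,G\models^d\varphi$ is defined recursively: $r(x,y)$ holds iff $(g(x),g(y))\in I(r)$; $X(x)$ holds iff $g(x)\in G(X)$; $\neg,\wedge$ are classical; $\exists x.\varphi$ holds iff $\langle I,D,E\rangle,g[x\leftarrow d],G\models^d\varphi$ for some $d\in D$; $\exists X.\varphi$ holds iff $\langle I,D,E\rangle,g,G\langle X\leftarrow S\rangle\models^d\varphi$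 for some $S\in E$. Here $g[x\leftarrow d]$ and $G\langle X\leftarrow S\rangle$ are the usual updates. **Elementary substructure.** $\langle I',D',E'\rangle\subseteq_E\langle I,D,E\rangle$ means: $D'\subseteq D$, $E'\subseteq E$, and for every formula $\psi$, every $g$ with $\mathrm{Range}(g)\subseteq D'$ and every $G$ with $\mathrm{Range}(G)\subseteq E'$, $\langle I',D',E'\rangle,g,G\models^d\psi$ iff $\langle I,D,E\rangle,g,G\models^d\psi$. (The subscript $E$ in $\subseteq_E$ is just part of the notation.) "Countable" means finite or countably infinite. *)

theory Defs
  imports Main "HOL-Library.Countable_Set"
begin

type_synonym rel_symbol = nat
type_synonym fo_var = nat
type_synonym so_var = nat

datatype mso =
    Rel rel_symbol fo_var fo_var
  | Mem so_var fo_var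
  | Neg mso
  | Conj mso mso
  | ExFO fo_var mso
  | ExSO so_var mso

(* The nonempty set of individuals is the type 'u. *)
type_synonym 'u interp = "rel_symbol \<Rightarrow> 'u rel"
type_synonym 'u struct = "'u interp \<times> 'u set \<times> 'u set set"

fun sat :: "'u struct \<Rightarrow> (fo_var \<Rightarrow> 'u) \<Rightarrow> (so_var \<Rightarrow> 'u set) \<Rightarrow> mso \<Rightarrow> bool" where
  "sat (I, D, E) g G (Rel r x y) \<longleftrightarrow> (g x, g y) \<in> I r"
| "sat (I, D, E) g G (Mem X x) \<longleftrightarrow> g x \<in> G X"
| "sat (I, D, E) g G (Neg \<phi>) \<longleftrightarrow> \<not> sat (I, D, E) g G \<phi>"
| "sat (I, D, E) g G (Conj \<phi> \<psi>) \<longleftrightarrow> sat (I, D, E) g G \<phi> \<and> sat (I, D, E) g G \<psi>"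
| "sat (I, D, E) g G (ExFO x \<phi>) \<longleftrightarrow> (\<exists>d\<in>D. sat (I, D, E) (g(x := d)) G \<phi>)"
| "sat (I, D, E) g G (ExSO X \<phi>) \<longleftrightarrow> (\<exists>S\<in>E. sat (I, D, E) g (G(X := S)) \<phi>)"

fun elem_substruct :: "'u struct \<Rightarrow> 'u struct \<Rightarrow> bool" where
  "elem_substruct (I', D', E') (I, D, E) \<longleftrightarrow>
     D' \<subseteq> D \<and> E' \<subseteq> E \<and>
     (\<forall>\<psi> g G. range g \<subseteq> D' \<longrightarrow> range G \<subseteq> E' \<longrightarrow>
        (sat (I', D', E') g G \<psi> \<longleftrightarrow> sat (I, D, E) g G \<psi>))"

end

theory Submission
  imports Defs
begin

text \<open>
  Close \<open>D\<^sub>0\<close> and \<open>E\<^sub>0\<close> under witnesses for existential formulas and apply the Tarski--Vaught test.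
  There may be uncountably many assignments into a countable set, but a formula only sees finitely
  many variables, so finite lists of parameters suffice, and there are countably many of them.
  A parameter list \<open>xs\<close> is read as the assignment \<open>(!) xs\<close>, whose unspecified values beyond the
  length of \<open>xs\<close> are never inspected.
\<close>

instance mso :: countable
  by countable_datatype

text \<open>A bound \<open>k\<close> on indices replaces the set of free variables, so that
  agreement concerns an initial segment of each assignment, which a list can store. One bound serves
  both kinds of variables.\<close>

lemma sat_cong_below:
  "\<exists>k. \<forall>g g' G G'. (\<forall>n<k. g n = g' n \<and> G n = G' n) \<longrightarrow>
     sat (I, D, E) g G \<phi> = sat (I, D, E) g' G' \<phi>"
proof (induction \<phi>)
  case (Rel r x y)
  show ?case by (rule exI[of _ "Suc (max x y)"]) auto
next
  case (Mem X x)
  show ?case by (rule exI[of _ "Suc (max X x)"]) auto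
next
  case (Neg \<phi>)
  then obtain k where k: "\<forall>g g' G G'. (\<forall>n<k. g n = g' n \<and> G n = G' n) \<longrightarrow>
      sat (I, D, E) g G \<phi> = sat (I, D, E) g' G' \<phi>"
    by (rule exE)
  show ?case
  proof (intro exI allI impI)
    fix g g' :: "fo_var \<Rightarrow> 'a" and G G' :: "so_var \<Rightarrow> 'a set"
    assume "\<forall>n<k. g n = g' n \<and> G n = G' n"
    then have "sat (I, D, E) g G \<phi> = sat (I, D, E) g' G' \<phi>"
      by (intro k[rule_format]) simp
    then show "sat (I, D, E) g G (Neg \<phi>) = sat (I, D, E) g' G' (Neg \<phi>)"
      by simp
  qed
next
  case (Conj \<phi> \<psi>)
  then obtain k l
    where k: "\<forall>g g' G G'. (\<forall>n<k. g n = g' n \<and> G n = G' n) \<longrightarrow>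
        sat (I, D, E) g G \<phi> = sat (I, D, E) g' G' \<phi>"
      and l: "\<forall>g g' G G'. (\<forall>n<l. g n = g' n \<and> G n = G' n) \<longrightarrow>
        sat (I, D, E) g G \<psi> = sat (I, D, E) g' G' \<psi>"
    by (elim exE)
  show ?case
  proof (intro exI allI impI)
    fix g g' :: "fo_var \<Rightarrow> 'a" and G G' :: "so_var \<Rightarrow> 'a set"
    \<comment> \<open>This instantiates the bound that \<open>exI\<close> left schematic; the
      maximum gives agreement below \<open>k\<close> and below \<open>l\<close>.\<close>
    assume eq: "\<forall>n<max k l. g n = g' n \<and> G n = G' n"
    then have "sat (I, D, E) g G \<phi> = sat (I, D, E) g' G' \<phi>"
      by (intro k[rule_format]) simp
    moreover from eq have "sat (I, D, E) g G \<psi> = sat (I, D, E) g' G' \<psi>"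
      by (intro l[rule_format]) simp
    ultimately show "sat (I, D, E) g G (Conj \<phi> \<psi>) = sat (I, D, E) g' G' (Conj \<phi> \<psi>)"
      by simp
  qed
next
  case (ExFO x \<phi>)
  then obtain k where k: "\<forall>g g' G G'. (\<forall>n<k. g n = g' n \<and> G n = G' n) \<longrightarrow>
      sat (I, D, E) g G \<phi> = sat (I, D, E) g' G' \<phi>"
    by (rule exE)
  show ?case
  proof (intro exI allI impI)
    fix g g' :: "fo_var \<Rightarrow> 'a" and G G' :: "so_var \<Rightarrow> 'a set"
    assume "\<forall>n<k. g n = g' n \<and> G n = G' n"
    \<comment> \<open>Both assignments receive the same value at \<open>x\<close>, so they still
      agree below \<open>k\<close> and the bound of the body can be kept.\<close>
    then have "sat (I, D, E) (g(x := d)) G \<phi> = sat (I, D, E) (g'(x := d)) G' \<phi>" for d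
      by (intro k[rule_format]) simp
    then show "sat (I, D, E) g G (ExFO x \<phi>) = sat (I, D, E) g' G' (ExFO x \<phi>)"
      by simp
  qed
next
  case (ExSO X \<phi>)
  then obtain k where k: "\<forall>g g' G G'. (\<forall>n<k. g n = g' n \<and> G n = G' n) \<longrightarrow>
      sat (I, D, E) g G \<phi> = sat (I, D, E) g' G' \<phi>"
    by (rule exE)
  show ?case
  proof (intro exI allI impI)
    fix g g' :: "fo_var \<Rightarrow> 'a" and G G' :: "so_var \<Rightarrow> 'a set"
    assume "\<forall>n<k. g n = g' n \<and> G n = G' n"
    then have "sat (I, D, E) g (G(X := S)) \<phi> = sat (I, D, E) g' (G'(X := S)) \<phi>" for S
      by (intro k[rule_format]) simp
    then show "sat (I, D, E) g G (ExSO X \<phi>) = sat (I, D, E) g' G' (ExSO X \<phi>)"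
      by simp
  qed
qed

text \<open>The cut-off from \<open>sat_cong_below\<close> depends on \<open>\<phi>\<close> but not
  on the assignments. Equal updates preserve agreement below it, so one pair of initial segments
  serves every update of either kind.\<close>

lemma sat_list_assignment:
  assumes "range g \<subseteq> A" and "range G \<subseteq> B"
  obtains xs Ys where "xs \<in> lists A" and "Ys \<in> lists B"
    and "\<And>x d. sat (I, D, E) (((!) xs)(x := d)) ((!) Ys) \<phi> = sat (I, D, E) (g(x := d)) G \<phi>"
    and "\<And>X S. sat (I, D, E) ((!) xs) (((!) Ys)(X := S)) \<phi> = sat (I, D, E) g (G(X := S)) \<phi>"
proof -
  obtain k where k: "\<forall>g g' G G'. (\<forall>n<k. g n = g' n \<and> G n = G' n) \<longrightarrow>
      sat (I, D, E) g G \<phi> = sat (I, D, E) g' G' \<phi>"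
    using sat_cong_below by (rule exE)
  show thesis
  proof (rule that[of "map g [0..<k]" "map G [0..<k]"])
    show "map g [0..<k] \<in> lists A" "map G [0..<k] \<in> lists B"
      using assms by (auto simp: image_subset_iff)
  qed (intro k[rule_format]; simp)+
qed

text \<open>Parameters come from \<open>A\<close>, \<open>B\<close> and witnesses from
  \<open>A'\<close>, \<open>B'\<close>, while truth is always evaluated in the large structure
  \<open>s\<close>. With distinct pairs this describes one round of closure; with
  \<open>A' = A\<close> and \<open>B' = B\<close> it is the Tarski-Vaught criterion.\<close>

definition witnessed ::
  "'u struct \<Rightarrow> 'u set \<Rightarrow> 'u set set \<Rightarrow> 'u set \<Rightarrow> 'u set set \<Rightarrow> bool" where
  "witnessed s A B A' B' \<longleftrightarrow> (\<forall>\<phi>. \<forall>xs\<in>lists A. \<forall>Ys\<in>lists B.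
     (\<forall>x. (\<exists>d\<in>fst (snd s). sat s (((!) xs)(x := d)) ((!) Ys) \<phi>) \<longrightarrow>
          (\<exists>d\<in>A'. sat s (((!) xs)(x := d)) ((!) Ys) \<phi>)) \<and>
     (\<forall>X. (\<exists>S\<in>snd (snd s). sat s ((!) xs) (((!) Ys)(X := S)) \<phi>) \<longrightarrow>
          (\<exists>S\<in>B'. sat s ((!) xs) (((!) Ys)(X := S)) \<phi>)))"

lemma tarski_vaught:
  assumes "N \<subseteq> D" and "M \<subseteq> E" and wit: "witnessed (I, D, E) N M N M"
  shows "elem_substruct (I, N, M) (I, D, E)"
proof -
  have "sat (I, N, M) g G \<psi> = sat (I, D, E) g G \<psi>"
    if "range g \<subseteq> N" and "range G \<subseteq> M" for \<psi> g G
    using that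
  proof (induction \<psi> arbitrary: g G)
    case (ExFO x \<phi>)
    obtain xs Ys where lists: "xs \<in> lists N" "Ys \<in> lists M"
      and eq: "\<And>d. sat (I, D, E) (((!) xs)(x := d)) ((!) Ys) \<phi> = sat (I, D, E) (g(x := d)) G \<phi>"
      using sat_list_assignment[OF ExFO.prems] by metis
    from lists have "(\<exists>d\<in>D. sat (I, D, E) (((!) xs)(x := d)) ((!) Ys) \<phi>) \<longrightarrow>
        (\<exists>d\<in>N. sat (I, D, E) (((!) xs)(x := d)) ((!) Ys) \<phi>)"
      using wit unfolding witnessed_def fst_conv snd_conv by blast
    \<comment> \<open>Back from lists to the given assignments; the converse direction is
      \<open>N \<subseteq> D\<close>.\<close>
    then have "(\<exists>d\<in>D. sat (I, D, E) (g(x := d)) G \<phi>) \<longleftrightarrow>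
        (\<exists>d\<in>N. sat (I, D, E) (g(x := d)) G \<phi>)"
      unfolding eq using \<open>N \<subseteq> D\<close> by blast
    \<comment> \<open>Since \<open>d \<in> N\<close>, the updated assignment stays within
      \<open>N\<close>, as the induction hypothesis requires.\<close>
    moreover have "sat (I, N, M) (g(x := d)) G \<phi> = sat (I, D, E) (g(x := d)) G \<phi>" if "d \<in> N" for d
      using ExFO.prems that by (intro ExFO.IH) auto
    ultimately show ?case by auto
  next
    \<comment> \<open>Set quantifiers range over the family \<open>E\<close> only, so sets behave
      like a second sort of individuals and the first-order argument carries over.\<close>
    case (ExSO X \<phi>)
    obtain xs Ys where lists: "xs \<in> lists N" "Ys \<in> lists M"
      and eq: "\<And>S. sat (I, D, E) ((!) xs) (((!) Ys)(X := S)) \<phi> = sat (I, D, E) g (G(X := S)) \<phi>"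
      using sat_list_assignment[OF ExSO.prems] by metis
    from lists have "(\<exists>S\<in>E. sat (I, D, E) ((!) xs) (((!) Ys)(X := S)) \<phi>) \<longrightarrow>
        (\<exists>S\<in>M. sat (I, D, E) ((!) xs) (((!) Ys)(X := S)) \<phi>)"
      using wit unfolding witnessed_def fst_conv snd_conv by blast
    then have "(\<exists>S\<in>E. sat (I, D, E) g (G(X := S)) \<phi>) \<longleftrightarrow>
        (\<exists>S\<in>M. sat (I, D, E) g (G(X := S)) \<phi>)"
      unfolding eq using \<open>M \<subseteq> E\<close> by blast
    moreover have "sat (I, N, M) g (G(X := S)) \<phi> = sat (I, D, E) g (G(X := S)) \<phi>" if "S \<in> M" for S
      using ExSO.prems that by (intro ExSO.IH) auto
    ultimately show ?case by auto
  qed auto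
  with assms show ?thesis by simp
qed

text \<open>Choice picks one witness for each index in \<open>P\<close> that has any, and the image
  of a countable set is countable.\<close>

lemma countable_witnesses:
  assumes "countable P"
  shows "\<exists>W\<subseteq>D. countable W \<and> (\<forall>p\<in>P. (\<exists>d\<in>D. Q p d) \<longrightarrow> (\<exists>d\<in>W. Q p d))"
proof -
  let ?P = "{p \<in> P. \<exists>d\<in>D. Q p d}"
  obtain w where w: "\<forall>p\<in>?P. w p \<in> D \<and> Q p (w p)"
    using bchoice[of ?P "\<lambda>p d. d \<in> D \<and> Q p d"] by blast
  have "countable ?P"
    by (rule countable_subset[OF _ assms]) auto
  with w show ?thesis
    by (intro exI[of _ "w ` ?P"]) auto
qed

text \<open>One round of closure. The added witnesses can become parameters of new existential
  statements, so the round has to be iterated.\<close>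

lemma ex_witnessed_extension:
  assumes "countable A" "A \<subseteq> D" "countable B" "B \<subseteq> E"
  shows "\<exists>A' B'. countable A' \<and> A \<subseteq> A' \<and> A' \<subseteq> D \<and> countable B' \<and> B \<subseteq> B' \<and> B' \<subseteq> E \<and>
    witnessed (I, D, E) A B A' B'"
proof -
  \<comment> \<open>Each index is a formula, two parameter lists and the quantified variable. The
    same index set serves both kinds of quantifier because both kinds of variables are natural
    numbers.\<close>
  let ?P = "(UNIV :: mso set) \<times> lists A \<times> lists B \<times> (UNIV :: nat set)"
  have P: "countable ?P"
    using assms by (intro countable_SIGMA countable_lists) auto
  obtain V where V: "V \<subseteq> D" "countable V"
    "\<forall>p\<in>?P. (\<exists>d\<in>D. case p of (\<phi>, xs, Ys, x) \<Rightarrow> sat (I, D, E) (((!) xs)(x := d)) ((!) Ys) \<phi>) \<longrightarrow>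
      (\<exists>d\<in>V. case p of (\<phi>, xs, Ys, x) \<Rightarrow> sat (I, D, E) (((!) xs)(x := d)) ((!) Ys) \<phi>)"
    using countable_witnesses[OF P, of D "\<lambda>p d. case p of (\<phi>, xs, Ys, x) \<Rightarrow>
      sat (I, D, E) (((!) xs)(x := d)) ((!) Ys) \<phi>"] by blast
  obtain W where W: "W \<subseteq> E" "countable W"
    "\<forall>p\<in>?P. (\<exists>S\<in>E. case p of (\<phi>, xs, Ys, X) \<Rightarrow> sat (I, D, E) ((!) xs) (((!) Ys)(X := S)) \<phi>) \<longrightarrow>
      (\<exists>S\<in>W. case p of (\<phi>, xs, Ys, X) \<Rightarrow> sat (I, D, E) ((!) xs) (((!) Ys)(X := S)) \<phi>)"
    using countable_witnesses[OF P, of E "\<lambda>p S. case p of (\<phi>, xs, Ys, X) \<Rightarrow>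
      sat (I, D, E) ((!) xs) (((!) Ys)(X := S)) \<phi>"] by blast
  have "witnessed (I, D, E) A B (A \<union> V) (B \<union> W)"
    unfolding witnessed_def
  proof (intro allI ballI conjI impI)
    fix \<phi> xs Ys x
    assume "xs \<in> lists A" "Ys \<in> lists B"
      and "\<exists>d\<in>fst (snd (I, D, E)). sat (I, D, E) (((!) xs)(x := d)) ((!) Ys) \<phi>"
    then show "\<exists>d\<in>A \<union> V. sat (I, D, E) (((!) xs)(x := d)) ((!) Ys) \<phi>"
      using V(3)[rule_format, of "(\<phi>, xs, Ys, x)"] by auto
  next
    fix \<phi> xs Ys X
    assume "xs \<in> lists A" "Ys \<in> lists B"
      and "\<exists>S\<in>snd (snd (I, D, E)). sat (I, D, E) ((!) xs) (((!) Ys)(X := S)) \<phi>"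
    then show "\<exists>S\<in>B \<union> W. sat (I, D, E) ((!) xs) (((!) Ys)(X := S)) \<phi>"
      using W(3)[rule_format, of "(\<phi>, xs, Ys, X)"] by auto
  qed
  with V W assms show ?thesis
    by (intro exI[of _ "A \<union> V"] exI[of _ "B \<union> W"]) auto
qed

text \<open>A list has finitely many entries, so the largest of the stages at which they appear
  contains them all.\<close>

lemma lists_UN_mono:
  fixes C :: "nat \<Rightarrow> 'a set"
  assumes "mono C" and "xs \<in> lists (\<Union>n. C n)"
  shows "\<exists>n. xs \<in> lists (C n)"
  using assms(2)
proof (induction xs)
  case (Cons x xs)
  then obtain m n where "x \<in> C m" "xs \<in> lists (C n)" by auto
  moreover have "C m \<subseteq> C (max m n)" "C n \<subseteq> C (max m n)"
    using assms(1) by (simp_all add: monoD)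
  ultimately have "x # xs \<in> lists (C (max m n))"
    using lists_mono by auto
  then show ?case ..
qed simp

text \<open>Parameters from the limit already lie in some stage \<open>n\<close>, and their
  witnesses appear in stage \<open>Suc n\<close>, hence again in the limit.\<close>

lemma witnessed_UN:
  fixes A :: "nat \<Rightarrow> 'u set"
  assumes "mono A" "mono B" and wit: "\<And>n. witnessed s (A n) (B n) (A (Suc n)) (B (Suc n))"
  shows "witnessed s (\<Union>n. A n) (\<Union>n. B n) (\<Union>n. A n) (\<Union>n. B n)"
proof -
  \<comment> \<open>Both lists must lie in a common stage before \<open>wit\<close> applies; the
    maximum of their two stages is one.\<close>
  have stage: "\<exists>n. xs \<in> lists (A n) \<and> Ys \<in> lists (B n)"
    if xs: "xs \<in> lists (\<Union>n. A n)" and Ys: "Ys \<in> lists (\<Union>n. B n)" for xs Ys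
  proof -
    obtain m n where "xs \<in> lists (A m)" "Ys \<in> lists (B n)"
      using lists_UN_mono[OF \<open>mono A\<close> xs] lists_UN_mono[OF \<open>mono B\<close> Ys] by blast
    moreover have "A m \<subseteq> A (max m n)" "B n \<subseteq> B (max m n)"
      using assms(1,2) by (simp_all add: monoD)
    ultimately have "xs \<in> lists (A (max m n))" "Ys \<in> lists (B (max m n))"
      by auto
    then show ?thesis by blast
  qed
  show ?thesis
    unfolding witnessed_def
  proof (intro allI ballI conjI impI)
    fix \<phi> xs Ys x
    assume lists: "xs \<in> lists (\<Union>n. A n)" "Ys \<in> lists (\<Union>n. B n)"
      and ex: "\<exists>d\<in>fst (snd s). sat s (((!) xs)(x := d)) ((!) Ys) \<phi>"
    obtain n where "xs \<in> lists (A n)" "Ys \<in> lists (B n)"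
      using stage[OF lists] by blast
    with ex have "\<exists>d\<in>A (Suc n). sat s (((!) xs)(x := d)) ((!) Ys) \<phi>"
      using wit[of n] unfolding witnessed_def by simp
    then show "\<exists>d\<in>\<Union>n. A n. sat s (((!) xs)(x := d)) ((!) Ys) \<phi>"
      by blast
  next
    fix \<phi> xs Ys X
    assume lists: "xs \<in> lists (\<Union>n. A n)" "Ys \<in> lists (\<Union>n. B n)"
      and ex: "\<exists>S\<in>snd (snd s). sat s ((!) xs) (((!) Ys)(X := S)) \<phi>"
    obtain n where "xs \<in> lists (A n)" "Ys \<in> lists (B n)"
      using stage[OF lists] by blast
    with ex have "\<exists>S\<in>B (Suc n). sat s ((!) xs) (((!) Ys)(X := S)) \<phi>"
      using wit[of n] unfolding witnessed_def by simp
    then show "\<exists>S\<in>\<Union>n. B n. sat s ((!) xs) (((!) Ys)(X := S)) \<phi>"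
      by blast
  qed
qed

theorem mainTheorem4:
  fixes I :: "'u interp"
    and D D\<^sub>0 :: "'u set"
    and E E\<^sub>0 :: "'u set set"
  assumes "D\<^sub>0 \<subseteq> D" and "countable D\<^sub>0" and "D\<^sub>0 \<noteq> {}"
    and "E\<^sub>0 \<subseteq> E" and "countable E\<^sub>0" and "E\<^sub>0 \<noteq> {}"
  shows "\<exists>N M. countable N \<and> countable M \<and>
           D\<^sub>0 \<subseteq> N \<and> N \<subseteq> D \<and> E\<^sub>0 \<subseteq> M \<and> M \<subseteq> E \<and>
           elem_substruct (I, N, M) (I, D, E)"
proof -
  \<comment> \<open>The invariant keeps what the next round needs, countability and the inclusions
    in \<open>D\<close> and \<open>E\<close>, together with the inclusions of
    \<open>D\<^sub>0\<close> and \<open>E\<^sub>0\<close> that the conclusion asks for.\<close>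
  let ?inv = "\<lambda>(A, B). countable A \<and> D\<^sub>0 \<subseteq> A \<and> A \<subseteq> D \<and> countable B \<and> E\<^sub>0 \<subseteq> B \<and> B \<subseteq> E"
  let ?step = "\<lambda>(A, B) (A', B'). A \<subseteq> A' \<and> B \<subseteq> B' \<and> witnessed (I, D, E) A B A' B'"
  have start: "\<exists>p. ?inv p"
    using assms by (intro exI[of _ "(D\<^sub>0, E\<^sub>0)"]) auto
  have ext: "\<exists>q. ?inv q \<and> ?step p q" if "?inv p" for p
  proof -
    obtain A B where p: "p = (A, B)" by fastforce
    with that obtain A' B' where "countable A'" "A \<subseteq> A'" "A' \<subseteq> D" "countable B'" "B \<subseteq> B'" "B' \<subseteq> E"
      "witnessed (I, D, E) A B A' B'"
      using ex_witnessed_extension[of A D B E I] by auto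
    with that p show ?thesis
      by (intro exI[of _ "(A', B')"]) auto
  qed
  \<comment> \<open>Extensions are only known to exist, so the chain of stages comes from dependent
    choice.\<close>
  have "\<exists>f. \<forall>n. ?inv (f n) \<and> ?step (f n) (f (Suc n))"
    by (rule dependent_nat_choice[where P = "\<lambda>_. ?inv" and Q = "\<lambda>_. ?step"])
      (fact start ext)+
  then obtain f where f: "\<forall>n. ?inv (f n) \<and> ?step (f n) (f (Suc n))" ..
  define A B where "A n = fst (f n)" and "B n = snd (f n)" for n
  have inv: "countable (A n)" "D\<^sub>0 \<subseteq> A n" "A n \<subseteq> D" "countable (B n)" "E\<^sub>0 \<subseteq> B n" "B n \<subseteq> E" for n
    using f[rule_format, of n] by (auto simp: A_def B_def split: prod.splits)
  have step: "A n \<subseteq> A (Suc n)" "B n \<subseteq> B (Suc n)"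
    "witnessed (I, D, E) (A n) (B n) (A (Suc n)) (B (Suc n))" for n
    using f[rule_format, of n] by (auto simp: A_def B_def split: prod.splits)
  have "elem_substruct (I, \<Union>n. A n, \<Union>n. B n) (I, D, E)"
  proof (rule tarski_vaught)
    show "(\<Union>n. A n) \<subseteq> D" "(\<Union>n. B n) \<subseteq> E"
      using inv by blast+
    have "mono A" "mono B"
      using step by (auto simp: mono_iff_le_Suc)
    then show "witnessed (I, D, E) (\<Union>n. A n) (\<Union>n. B n) (\<Union>n. A n) (\<Union>n. B n)"
      using step(3) by (rule witnessed_UN)
  qed
  moreover have "countable (\<Union>n. A n)" "countable (\<Union>n. B n)"
    using inv by simp_all
  moreover have "D\<^sub>0 \<subseteq> (\<Union>n. A n)" "(\<Union>n. A n) \<subseteq> D" "E\<^sub>0 \<subseteq> (\<Union>n. B n)" "(\<Union>n. B n) \<subseteq> E"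
    using inv by (simp_all add: UN_least SUP_upper2[of 0])
  ultimately show ?thesis by (intro exI conjI)
qed

end
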